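(* Let $\mathcal{H}$ be a real Hilbert space, $R:\mathcal{H}\to\,]-\infty,+\infty]$ proper convex lower semicontinuous, and $F:\mathcal{H}\to\mathbb{R}$ convex and continuously differentiable with $(1/\beta)$-Lipschitz gradient, $\beta>0$. Let $\Phi:=F+R$ and assume $\operatorname{Argmin}(\Phi)\ne\emptyset$; let $x^\star\in\operatorname{Argmin}(\Phi)$. Let $0<\underline{\gamma}\le\gamma_k\le\overline{\gamma}<2\beta$ with $\gamma_k\to\gamma\in[\underline\gamma,\overline\gamma]$ and $\sum_{k\in\mathbb{N}}|\gamma_k-\gamma|<+\infty$. Let $x_0\in\mathcal{H}$ and consider the non-stationary Forward--Backward iteration $$x_{k+1}=\mathrm{prox}_{\gamma_kR}\big(x_k-\gamma_k\nabla F(x_k)\big),\quad k\ge0.$$ Then $$\Phi(x_k)-\Phi(x^\star)=o\big(1/(k+1)\big).$$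
   Context: $\mathrm{prox}_{\gamma R}(x)=\operatorname{argmin}_{u\in\mathcal{H}}\gamma R(u)+\frac12\|u-x\|^2$. *)

theory Defs
  imports "HOL-Analysis.Analysis" "HOL-Library.Landau_Symbols"
begin

(* Functions into ]-oo,+oo] are rendered as ereal-valued functions; properness
   excludes the value -oo, so the sums and scalings below are never indeterminate. *)

definition proper_fun :: "('a \<Rightarrow> ereal) \<Rightarrow> bool" where
  "proper_fun f \<longleftrightarrow> (\<forall>x. f x \<noteq> -\<infinity>) \<and> (\<exists>x. f x \<noteq> \<infinity>)"

(* At u = 0 or v = 0 this uses 0 * oo = 0 in ereal, which makes the inequality trivial there. *)
definition convex_fun :: "('a::real_vector \<Rightarrow> ereal) \<Rightarrow> bool" where
  "convex_fun f \<longleftrightarrow>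
    (\<forall>x y. \<forall>u\<ge>0. \<forall>v\<ge>0. u + v = 1 \<longrightarrow>
      f (u *\<^sub>R x + v *\<^sub>R y) \<le> ereal u * f x + ereal v * f y)"

definition lsc_fun :: "('a::topological_space \<Rightarrow> ereal) \<Rightarrow> bool" where
  "lsc_fun f \<longleftrightarrow> (\<forall>x. f x \<le> Liminf (at x) f)"

definition Argmin :: "('a \<Rightarrow> ereal) \<Rightarrow> 'a set" where
  "Argmin f = {x. is_arg_min f (\<lambda>_. True) x}"

(* For R proper, convex and lsc on a Hilbert space and \<gamma> > 0 the minimizer exists
   and is unique, so the choice made by arg_min is the only possible one. *)
definition prox :: "real \<Rightarrow> ('a::real_inner \<Rightarrow> ereal) \<Rightarrow> 'a \<Rightarrow> 'a" where
  "prox \<gamma> R x = arg_min (\<lambda>u. ereal \<gamma> * R u + ereal (1 / 2 * (norm (u - x))\<^sup>2)) (\<lambda>_. True)"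

(* f = o(g) for an extended-real f and a real g: such an f is eventually finite.
   Finiteness is stated because real_of_ereal sends infinite values to 0. *)
definition smallo_ereal :: "(nat \<Rightarrow> ereal) \<Rightarrow> (nat \<Rightarrow> real) \<Rightarrow> bool" where
  "smallo_ereal f g \<longleftrightarrow>
    (\<forall>\<^sub>F k in sequentially. \<bar>f k\<bar> \<noteq> \<infinity>) \<and> (\<lambda>k. real_of_ereal (f k)) \<in> o(g)"

end

theory Submission
  imports Defs
begin

text \<open>
  Comparing the prox step with the descent lemma gives, for every \<open>u\<close>,
  \<open>\<Phi> (x (Suc k)) + \<langle>x k - x (Suc k), u - x (Suc k)\<rangle> / \<gamma>s k - \<parallel>x k - x (Suc k)\<parallel>\<^sup>2 / (2 * \<beta>) \<le> \<Phi> u\<close>.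
  Taking \<open>u = x k\<close> shows that \<open>\<Phi> (x k)\<close> decreases and, as \<open>\<gamma>hi < 2 * \<beta>\<close>, that the squared step
  lengths are summable. Taking \<open>u = xstar\<close> bounds the gap by a telescoping term plus a multiple of the
  squared step length, so the gaps are summable; being also decreasing, they are \<open>o(1/(k+1))\<close>.
\<close>

section \<open>Real sequences: decay rates and summability\<close>

text \<open>The block of indices from \<open>n div 2\<close> to \<open>n\<close> has at least
  \<open>(n + 1) / 2\<close> terms, each at least \<open>v n\<close>. So
  \<open>(n + 1) * v n\<close> is at most twice a difference of two partial sums with the same
  limit, and is squeezed to 0.\<close>

lemma decseq_summable_smallo:
  fixes v :: "nat \<Rightarrow> real"
  assumes dec: "decseq v" and sm: "summable v"
  shows "v \<in> o(\<lambda>k. 1 / (real k + 1))"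
proof -
  have lim0: "v \<longlonglongrightarrow> 0" using summable_LIMSEQ_zero[OF sm] .
  have v0: "v n \<ge> 0" for n using decseq_ge[OF dec lim0] .
  define S where "S = (\<lambda>n. \<Sum>k<n. v k)"
  have Slim: "S \<longlonglongrightarrow> suminf v"
    unfolding S_def using summable_LIMSEQ[OF sm] .
  have half: "filterlim (\<lambda>n::nat. n div 2) sequentially sequentially"
    unfolding filterlim_at_top
  proof
    fix Z :: nat
    show "eventually (\<lambda>x. Z \<le> x div 2) sequentially"
      unfolding eventually_sequentially by (rule exI[of _ "2*Z"]) auto
  qed
  have "(\<lambda>n. S (Suc n) - S (n div 2)) \<longlonglongrightarrow> suminf v - suminf v"
    by (intro tendsto_diff LIMSEQ_Suc Slim filterlim_compose[OF Slim half])
  then have "(\<lambda>n. 2 * (S (Suc n) - S (n div 2))) \<longlonglongrightarrow> 2 * (suminf v - suminf v)"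
    by (rule tendsto_mult_left)
  then have up: "(\<lambda>n. 2 * (S (Suc n) - S (n div 2))) \<longlonglongrightarrow> 0" by simp
  have bd: "v n * (real n + 1) \<le> 2 * (S (Suc n) - S (n div 2))" for n
  proof -
    have "S (Suc n) - S (n div 2) = (\<Sum>k=n div 2..<Suc n. v k)"
      unfolding S_def by (simp add: lessThan_atLeast0 sum_diff_nat_ivl del: sum.op_ivl_Suc)
    moreover have "(\<Sum>k=n div 2..<Suc n. v n) \<le> (\<Sum>k=n div 2..<Suc n. v k)"
      by (rule sum_mono) (use dec in \<open>auto simp: decseq_def\<close>)
    moreover have "(\<Sum>k=n div 2..<Suc n. v n) = real (Suc n - n div 2) * v n"
      by simp
    moreover have "(real n + 1) / 2 * v n \<le> real (Suc n - n div 2) * v n"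
    proof (rule mult_right_mono[OF _ v0])
      have "n + 1 \<le> 2 * (Suc n - n div 2)" by linarith
      then have "real (n + 1) \<le> real (2 * (Suc n - n div 2))" by (rule of_nat_mono)
      then show "(real n + 1) / 2 \<le> real (Suc n - n div 2)" unfolding of_nat_mult by simp
    qed
    ultimately show ?thesis by (simp add: field_simps)
  qed
  have "(\<lambda>n. v n * (real n + 1)) \<longlonglongrightarrow> 0"
    by (rule tendsto_sandwich[OF always_eventually always_eventually tendsto_const up])
      (use bd v0 in auto)
  then have "(\<lambda>n. v n / (1 / (real n + 1))) \<longlonglongrightarrow> 0" by simp
  then show ?thesis
    by (rule smalloI_tendsto) (auto simp: add_nonneg_eq_0_iff)
qed

text \<open>Summing \<open>step\<close> cancels the \<open>b\<close> terms in between, so the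
  partial sums of \<open>a\<close> never exceed \<open>b 0 + suminf s\<close>. It serves once with
  \<open>b\<close> the function gap and once with \<open>b\<close> the squared distance to the
  minimizer.\<close>

lemma summable_of_telescoping_bound:
  fixes a b s :: "nat \<Rightarrow> real"
  assumes a: "\<And>k. 0 \<le> a k" and b: "\<And>k. 0 \<le> b k" and s: "\<And>k. 0 \<le> s k" "summable s"
    and step: "\<And>k. a k + b (Suc k) \<le> b k + s k"
  shows "summable a"
proof (rule summableI_nonneg_bounded[OF a])
  fix n
  have "(\<Sum>k<n. a k) + b n \<le> b 0 + (\<Sum>k<n. s k)"
  proof (induction n)
    case (Suc n)
    then show ?case using step[of n] by simp
  qed simp
  also have "(\<Sum>k<n. s k) \<le> suminf s" using s by (intro sum_le_suminf) auto
  finally show "(\<Sum>k<n. a k) \<le> b 0 + suminf s" using b[of n] by linarith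
qed

section \<open>First-order inequalities for smooth functions\<close>

lemma has_derivative_along_line:
  fixes G :: "'a::real_inner \<Rightarrow> real"
  assumes "GDERIV G (p + t *\<^sub>R d) :> g"
  shows "((\<lambda>t. G (p + t *\<^sub>R d)) has_real_derivative inner d g) (at t)"
proof -
  have "((\<lambda>t. p + t *\<^sub>R d) has_derivative (\<lambda>h. h *\<^sub>R d)) (at t)"
    by (auto intro!: derivative_eq_intros)
  from has_derivative_compose[OF this assms[unfolded gderiv_def]]
  show ?thesis
    unfolding has_field_derivative_def
    by (rule has_derivative_eq_rhs) (simp add: fun_eq_iff mult.commute)
qed

text \<open>A lower bound on the difference quotients for small positive \<open>t\<close> survives
  the one-sided limit at 0. Both the gradient inequality for \<open>F\<close> and the optimality
  condition below reduce to this.\<close>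

lemma gderiv_ge_of_slope_ge:
  fixes G :: "'a::real_inner \<Rightarrow> real"
  assumes G: "GDERIV G p :> g"
    and slope: "\<And>t. 0 < t \<Longrightarrow> t \<le> 1 \<Longrightarrow> t * c \<le> G (p + t *\<^sub>R d) - G p"
  shows "c \<le> inner d g"
proof -
  have "((\<lambda>t. G (p + t *\<^sub>R d)) has_real_derivative inner d g) (at 0)"
    using has_derivative_along_line[of G p 0 d g] G by simp
  then have "((\<lambda>t. (G (p + t *\<^sub>R d) - G p) / t) \<longlongrightarrow> inner d g) (at 0)"
    by (simp add: has_field_derivative_iff)
  then have lim: "((\<lambda>t. (G (p + t *\<^sub>R d) - G p) / t) \<longlongrightarrow> inner d g) (at_right 0)"
    by (rule tendsto_mono[OF at_le, rotated]) simp
  have ev: "eventually (\<lambda>t. c \<le> (G (p + t *\<^sub>R d) - G p) / t) (at_right (0::real))"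
    unfolding eventually_at_right_field
    by (rule exI[of _ 1]) (use slope in \<open>auto simp: field_simps\<close>)
  show ?thesis
    by (rule tendsto_lowerbound[OF lim ev]) simp
qed

lemma convex_on_gradient_le:
  fixes F :: "'a::real_inner \<Rightarrow> real"
  assumes cvx: "convex_on UNIV F" and G: "GDERIV F p :> g"
  shows "F p + inner (u - p) g \<le> F u"
proof -
  \<comment> \<open>Convexity bounds the slopes of \<open>F\<close> from above, while the slope
    lemma takes lower bounds; hence the passage to \<open>- F\<close>.\<close>
  have "GDERIV (\<lambda>x. - F x) p :> - g"
    using G by (rule GDERIV_minus)
  then have "- (F u - F p) \<le> inner (u - p) (- g)"
  proof (rule gderiv_ge_of_slope_ge)
    fix t :: real assume t: "0 < t" "t \<le> 1"
    have "F ((1 - t) *\<^sub>R p + t *\<^sub>R u) \<le> (1 - t) * F p + t * F u"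
      using convex_onD[OF cvx, of t p u] t by simp
    moreover have "(1 - t) *\<^sub>R p + t *\<^sub>R u = p + t *\<^sub>R (u - p)"
      by (simp add: algebra_simps)
    ultimately show "t * - (F u - F p) \<le> - F (p + t *\<^sub>R (u - p)) - - F p"
      by (simp add: algebra_simps)
  qed
  then show ?thesis by simp
qed

text \<open>Along the segment from \<open>x\<close> to \<open>y\<close>, subtract from
  \<open>F\<close> its linearization and the quadratic
  \<open>L / 2 * (norm d)\<^sup>2 * t\<^sup>2\<close>. By Cauchy-Schwarz and the Lipschitz bound the
  remainder \<open>h\<close> has nonpositive derivative on [0,1], and \<open>h 1 \<le> h 0\<close>
  is the claim; no integral is taken.\<close>

lemma descent_lemma:
  fixes F :: "'a::real_inner \<Rightarrow> real"
  assumes G: "\<And>y. GDERIV F y :> gradF y" and lip: "L-lipschitz_on UNIV gradF"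
  shows "F y \<le> F x + inner (y - x) (gradF x) + L / 2 * (norm (y - x))\<^sup>2"
proof -
  define d where "d = y - x"
  define h where "h = (\<lambda>t. F (x + t *\<^sub>R d) - t * inner d (gradF x) - L / 2 * (norm d)\<^sup>2 * t\<^sup>2)"
  have "h 1 \<le> h 0"
  proof (rule DERIV_nonpos_imp_nonincreasing[of 0 1 h])
    fix t :: real assume t: "0 \<le> t" "t \<le> 1"
    have "(h has_real_derivative
        inner d (gradF (x + t *\<^sub>R d)) - inner d (gradF x) - L / 2 * (norm d)\<^sup>2 * (2 * t)) (at t)"
      unfolding h_def
      by (rule derivative_eq_intros has_derivative_along_line[OF G] refl | simp)+
    moreover have "inner d (gradF (x + t *\<^sub>R d)) - inner d (gradF x) \<le> L * t * (norm d)\<^sup>2"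
    proof -
      have "inner d (gradF (x + t *\<^sub>R d) - gradF x) \<le> norm d * norm (gradF (x + t *\<^sub>R d) - gradF x)"
        by (rule norm_cauchy_schwarz)
      also have "\<dots> \<le> norm d * (L * norm (t *\<^sub>R d))"
        using lipschitz_onD[OF lip, of "x + t *\<^sub>R d" x]
        by (intro mult_left_mono) (auto simp: dist_norm)
      finally show ?thesis
        using t by (simp add: inner_diff_right power2_eq_square algebra_simps)
    qed
    ultimately show "\<exists>y. (h has_real_derivative y) (at t) \<and> y \<le> 0"
      by (intro exI[of _ "inner d (gradF (x + t *\<^sub>R d)) - inner d (gradF x)
          - L / 2 * (norm d)\<^sup>2 * (2 * t)"] conjI) (simp_all add: algebra_simps)
  qed simp
  then show ?thesis by (simp add: h_def d_def)
qed

section \<open>Optimality condition for a smooth plus a convex function\<close>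

lemma proper_fun_cases:
  assumes "proper_fun R"
  obtains r where "R x = ereal r" | "R x = \<infinity>"
  using assms by (cases "R x") (auto simp: proper_fun_def)

text \<open>Fermat's rule: \<open>- g\<close> is a subgradient of \<open>R\<close> at
  \<open>p\<close>. On moving from \<open>p\<close> towards \<open>u\<close>, convexity lets
  \<open>R\<close> change by at most \<open>t * (R u - R p)\<close>, so minimality forces the slopes
  of \<open>G\<close> to be at least \<open>R p - R u\<close>. It is applied with
  \<open>G = F\<close> at \<open>xstar\<close> and with a quadratic \<open>G\<close> at a prox
  point.\<close>

lemma subgradient_of_minimizer:
  fixes R :: "'a::real_inner \<Rightarrow> ereal"
  assumes R: "proper_fun R" "convex_fun R" and G: "GDERIV G p :> g"
    and min: "\<And>u. ereal (G p) + R p \<le> ereal (G u) + R u"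
  shows "\<bar>R p\<bar> \<noteq> \<infinity>" and "R p \<le> R u + ereal (inner (u - p) g)"
proof -
  obtain u0 r0 where u0: "R u0 = ereal r0"
    by (metis R(1) ereal_cases proper_fun_def)
  obtain rp where rp: "R p = ereal rp"
    using min[of u0] u0 by (cases rule: proper_fun_cases[OF R(1), of p]) auto
  show "\<bar>R p\<bar> \<noteq> \<infinity>" by (simp add: rp)
  show "R p \<le> R u + ereal (inner (u - p) g)"
  proof (cases rule: proper_fun_cases[OF R(1), of u])
    case (1 ru)
    have "rp - ru \<le> inner (u - p) g"
    proof (rule gderiv_ge_of_slope_ge[OF G])
      fix t :: real assume t: "0 < t" "t \<le> 1"
      have "R ((1 - t) *\<^sub>R p + t *\<^sub>R u) \<le> ereal (1 - t) * R p + ereal t * R u"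
        using R(2) t unfolding convex_fun_def by (metis diff_add_cancel diff_ge_0_iff_ge less_imp_le)
      moreover have eq: "(1 - t) *\<^sub>R p + t *\<^sub>R u = p + t *\<^sub>R (u - p)"
        by (simp add: algebra_simps)
      ultimately have "R (p + t *\<^sub>R (u - p)) \<le> ereal ((1 - t) * rp + t * ru)"
        by (simp add: rp 1)
      with min[of "p + t *\<^sub>R (u - p)"] show "t * (rp - ru) \<le> G (p + t *\<^sub>R (u - p)) - G p"
        by (cases rule: proper_fun_cases[OF R(1), of "p + t *\<^sub>R (u - p)"])
          (auto simp: rp algebra_simps)
    qed
    then show ?thesis by (simp add: rp 1)
  qed simp
qed

section \<open>The proximal map: existence and subgradient inequality\<close>

text \<open>The quadratic term makes the objective strongly convex, so every minimizing sequence is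
  Cauchy; completeness gives a limit, and lower semicontinuity shows that the limit attains the
  infimum.\<close>

lemma prox_objective_has_minimizer:
  fixes R :: "'a::{real_inner, complete_space} \<Rightarrow> ereal"
  assumes R: "proper_fun R" "convex_fun R" "lsc_fun R" and \<gamma>: "\<gamma> > 0"
    and minorant: "\<And>u. ereal (c + inner u a) \<le> R u"
  shows "\<exists>p. is_arg_min (\<lambda>u. ereal \<gamma> * R u + ereal (1 / 2 * (norm (u - z))\<^sup>2)) (\<lambda>_. True) p"
proof -
  define D where "D = {u. R u \<noteq> \<infinity>}"
  define r where "r = (\<lambda>u. real_of_ereal (R u))"
  have Rr: "R u = ereal (r u)" if "u \<in> D" for u
    using that by (cases rule: proper_fun_cases[OF R(1), of u]) (auto simp: D_def r_def)
  define H where "H = (\<lambda>u. \<gamma> * r u + 1 / 2 * (norm (u - z))\<^sup>2)"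
  have Dne: "D \<noteq> {}" using R(1) by (auto simp: D_def proper_fun_def)
  \<comment> \<open>Completing the square: the affine minorant plus the quadratic differs from this
    constant by half of \<open>(norm (u - z + \<gamma> *\<^sub>R a))\<^sup>2\<close>.\<close>
  have lower: "\<gamma> * (c + inner z a) - \<gamma>\<^sup>2 * (norm a)\<^sup>2 / 2 \<le> H u" if "u \<in> D" for u
  proof -
    have "c + inner u a \<le> r u" using minorant[of u] Rr[OF that] by simp
    then have "\<gamma> * (c + inner u a) \<le> \<gamma> * r u" using \<gamma> by simp
    moreover have "(norm (u - z + \<gamma> *\<^sub>R a))\<^sup>2
        = (norm (u - z))\<^sup>2 + 2 * (\<gamma> * inner (u - z) a) + \<gamma>\<^sup>2 * (norm a)\<^sup>2"
      by (simp only: power2_norm_eq_inner inner_add_left inner_add_right inner_scaleR_left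
          inner_scaleR_right inner_commute[of a "u - z"]) (simp add: power2_eq_square distrib_left)
    moreover have "0 \<le> (norm (u - z + \<gamma> *\<^sub>R a))\<^sup>2" by simp
    moreover have "\<gamma> * inner (u - z) a = \<gamma> * (c + inner u a) - \<gamma> * (c + inner z a)"
      by (simp add: inner_diff_left algebra_simps)
    ultimately show ?thesis unfolding H_def by linarith
  qed
  have bdd: "bdd_below (H ` D)" using lower by (rule bdd_belowI2)
  define m where "m = Inf (H ` D)"
  have m: "m \<le> H u" if "u \<in> D" for u
    unfolding m_def using that bdd by (auto intro: cInf_lower)
  have "\<exists>u\<in>D. H u < m + 1 / real (Suc n)" for n
    using cInf_lessD[of "H ` D" "m + 1 / real (Suc n)"] Dne by (auto simp: m_def)
  then obtain u where uD: "\<And>n. u n \<in> D" and uH: "\<And>n. H (u n) < m + 1 / real (Suc n)"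
    by metis
  \<comment> \<open>The parallelogram identity at the midpoint \<open>?q\<close> gains
    \<open>(norm (v - w))\<^sup>2 / 8\<close> over plain convexity; compare with
    \<open>m \<le> H ?q\<close>.\<close>
  have mid: "(norm (v - w))\<^sup>2 \<le> 4 * (H v - m) + 4 * (H w - m)" if v: "v \<in> D" and w: "w \<in> D" for v w
  proof -
    let ?q = "(1/2) *\<^sub>R v + (1/2) *\<^sub>R w"
    have le: "R ?q \<le> ereal (1/2) * R v + ereal (1/2) * R w"
      by (rule R(2)[unfolded convex_fun_def, rule_format]) auto
    then have qD: "?q \<in> D" unfolding Rr[OF v] Rr[OF w] by (auto simp: D_def)
    from le have "r ?q \<le> (r v + r w) / 2" unfolding Rr[OF v] Rr[OF w] Rr[OF qD] by simp
    then have "\<gamma> * r ?q \<le> \<gamma> * ((r v + r w) / 2)" using \<gamma> by simp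
    moreover have "(norm (?q - z))\<^sup>2 = ((norm (v - z))\<^sup>2 + (norm (w - z))\<^sup>2) / 2 - (norm (v - w))\<^sup>2 / 4"
      by (simp add: power2_norm_eq_inner inner_add_left inner_add_right inner_diff_left
          inner_diff_right inner_commute field_simps)
    ultimately have "H ?q \<le> (H v + H w) / 2 - (norm (v - w))\<^sup>2 / 8"
      unfolding H_def by (simp add: algebra_simps)
    with m[OF qD] show ?thesis by (simp add: field_simps)
  qed
  have "Cauchy u"
  proof (rule metric_CauchyI)
    fix e :: real assume e: "e > 0"
    \<comment> \<open>With this \<open>N\<close> each excess \<open>H (u k) - m\<close> falls below
      \<open>e\<^sup>2 / 8\<close>, and the two factors 4 in \<open>mid\<close> add up to exactly
      \<open>e\<^sup>2\<close>.\<close>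
    obtain N where N: "8 / e\<^sup>2 < real N" using reals_Archimedean2 by blast
    have "dist (u i) (u j) < e" if ij: "i \<ge> N" "j \<ge> N" for i j
    proof -
      have close: "H (u k) - m < e\<^sup>2 / 8" if "k \<ge> N" for k
      proof -
        have "8 / e\<^sup>2 < real (Suc k)" using N that by simp
        then have "1 / real (Suc k) < e\<^sup>2 / 8" using e by (simp add: field_simps)
        with uH[of k] show ?thesis by argo
      qed
      have "(norm (u i - u j))\<^sup>2 < e\<^sup>2"
        using mid[OF uD uD, of i j] close[OF ij(1)] close[OF ij(2)] by argo
      then show ?thesis using e by (simp add: dist_norm power2_less_imp_less)
    qed
    then show "\<exists>M. \<forall>i\<ge>M. \<forall>j\<ge>M. dist (u i) (u j) < e" by blast
  qed
  then obtain p where p: "u \<longlonglongrightarrow> p" using Cauchy_convergent convergent_def by blast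
  \<comment> \<open>The bound says \<open>H p \<le> m\<close> in a form that does not presuppose
    \<open>R p\<close> finite. If it failed, a level \<open>s'\<close> strictly between would lie
    below \<open>R (u n)\<close> eventually, and the limit of \<open>H (u n)\<close> would exceed
    \<open>m\<close>.\<close>
  have Rp: "R p \<le> ereal ((m - 1 / 2 * (norm (p - z))\<^sup>2) / \<gamma>)" (is "_ \<le> ereal ?s")
  proof (rule ccontr)
    assume "\<not> ?thesis"
    then obtain s' where s': "ereal ?s < ereal s'" "ereal s' < R p"
      using ereal_dense2[of "ereal ?s" "R p"] by (auto simp: not_le)
    have "ereal s' < Liminf (at p) R"
      using R(3) s'(2) by (auto simp: lsc_fun_def intro: less_le_trans)
    then have "eventually (\<lambda>v. ereal s' < R v) (at p)" by (rule less_LiminfD)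
    \<comment> \<open>\<open>Liminf\<close> at \<open>p\<close> ignores \<open>p\<close> itself, but
      \<open>u n\<close> may equal \<open>p\<close>; the fact \<open>ereal s' < R p\<close> fills in
      the centre.\<close>
    then have "eventually (\<lambda>v. ereal s' < R v) (nhds p)"
      unfolding eventually_at_filter by (rule eventually_mono) (use s'(2) in auto)
    then have ev: "eventually (\<lambda>n. ereal s' < R (u n)) sequentially"
      using p by (rule eventually_compose_filterlim)
    have lim: "(\<lambda>n. \<gamma> * s' + 1 / 2 * (norm (u n - z))\<^sup>2 - 1 / real (Suc n))
        \<longlonglongrightarrow> \<gamma> * s' + 1 / 2 * (norm (p - z))\<^sup>2 - 0"
      by (intro tendsto_intros p LIMSEQ_Suc lim_1_over_n)
    have "\<gamma> * s' + 1 / 2 * (norm (p - z))\<^sup>2 - 0 \<le> m"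
    proof (rule tendsto_upperbound[OF lim])
      show "eventually (\<lambda>n. \<gamma> * s' + 1 / 2 * (norm (u n - z))\<^sup>2 - 1 / real (Suc n) \<le> m) sequentially"
        using ev
      proof (rule eventually_mono)
        fix n assume "ereal s' < R (u n)"
        then have "\<gamma> * s' \<le> \<gamma> * r (u n)" using \<gamma> by (simp add: Rr uD)
        then show "\<gamma> * s' + 1 / 2 * (norm (u n - z))\<^sup>2 - 1 / real (Suc n) \<le> m"
          using uH[of n] unfolding H_def by linarith
      qed
    qed simp
    moreover have "m - 1 / 2 * (norm (p - z))\<^sup>2 < \<gamma> * s'"
      using s'(1) \<gamma> by (simp add: field_simps)
    ultimately show False by linarith
  qed
  then have pD: "p \<in> D" by (auto simp: D_def)
  have "H p \<le> m" using Rp \<gamma> unfolding Rr[OF pD] H_def by (simp add: field_simps)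
  then have Hp: "H p \<le> H v" if "v \<in> D" for v using m[OF that] by linarith
  have "ereal \<gamma> * R p + ereal (1 / 2 * (norm (p - z))\<^sup>2)
      \<le> ereal \<gamma> * R v + ereal (1 / 2 * (norm (v - z))\<^sup>2)" for v
  proof (cases "v \<in> D")
    case True
    then show ?thesis using Hp[OF True] by (simp add: Rr pD H_def)
  next
    case False
    then show ?thesis using \<gamma> by (simp add: D_def)
  qed
  then show ?thesis unfolding is_arg_min_def by (auto simp: not_less)
qed

lemma prox_subgradient:
  fixes R :: "'a::{real_inner, complete_space} \<Rightarrow> ereal"
  assumes R: "proper_fun R" "convex_fun R" "lsc_fun R" and \<gamma>: "\<gamma> > 0"
    and minorant: "\<And>u. ereal (c + inner u a) \<le> R u"
  shows "\<bar>R (prox \<gamma> R z)\<bar> \<noteq> \<infinity>"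
    and "R (prox \<gamma> R z) \<le> R u + ereal (inner (u - prox \<gamma> R z) (prox \<gamma> R z - z) / \<gamma>)"
proof -
  define p where "p = prox \<gamma> R z"
  \<comment> \<open>The quadratic is divided by \<open>\<gamma>\<close>, so that \<open>R\<close>
    enters with coefficient 1 as the optimality condition requires; the gradient of \<open>G\<close>
    at \<open>p\<close> is \<open>(p - z) / \<gamma>\<close>.\<close>
  define G where "G = (\<lambda>u. 1 / (2 * \<gamma>) * (norm (u - z))\<^sup>2)"
  have "is_arg_min (\<lambda>u. ereal \<gamma> * R u + ereal (1 / 2 * (norm (u - z))\<^sup>2)) (\<lambda>_. True) p"
    unfolding p_def prox_def arg_min_def
    using prox_objective_has_minimizer[OF assms] by (rule someI_ex)
  then have min: "ereal \<gamma> * R p + ereal (1 / 2 * (norm (p - z))\<^sup>2)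
      \<le> ereal \<gamma> * R v + ereal (1 / 2 * (norm (v - z))\<^sup>2)" for v
    unfolding is_arg_min_def by (auto simp: not_less)
  have min': "ereal (G p) + R p \<le> ereal (G v) + R v" for v
  proof (cases rule: proper_fun_cases[OF R(1), of p]; cases rule: proper_fun_cases[OF R(1), of v])
    fix rp rv assume "R p = ereal rp" "R v = ereal rv"
    then have "\<gamma> * rp + (norm (p - z))\<^sup>2 / 2 \<le> \<gamma> * rv + (norm (v - z))\<^sup>2 / 2"
      using min[of v] by simp
    then have "(\<gamma> * rp + (norm (p - z))\<^sup>2 / 2) / \<gamma> \<le> (\<gamma> * rv + (norm (v - z))\<^sup>2 / 2) / \<gamma>"
      using \<gamma> by (simp add: divide_right_mono)
    then show ?thesis
      using \<gamma> \<open>R p = ereal rp\<close> \<open>R v = ereal rv\<close> by (simp add: G_def add_divide_distrib)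
  qed (use min[of v] \<gamma> in auto)
  have "(G has_derivative (\<lambda>h. inner h ((1 / \<gamma>) *\<^sub>R (p - z)))) (at p)"
    unfolding G_def power2_norm_eq_inner
    by (rule derivative_eq_intros refl | simp)+
      (use \<gamma> in \<open>simp add: fun_eq_iff field_simps inner_commute\<close>)
  then have G: "GDERIV G p :> (1 / \<gamma>) *\<^sub>R (p - z)" by (simp add: gderiv_def)
  show "\<bar>R (prox \<gamma> R z)\<bar> \<noteq> \<infinity>"
    using subgradient_of_minimizer(1)[OF R(1,2) G min'] by (simp add: p_def)
  show "R (prox \<gamma> R z) \<le> R u + ereal (inner (u - prox \<gamma> R z) (prox \<gamma> R z - z) / \<gamma>)"
    using subgradient_of_minimizer(2)[OF R(1,2) G min', of u] by (simp add: p_def)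
qed

section \<open>One forward-backward step\<close>

text \<open>Add three inequalities: the subgradient inequality at \<open>p\<close>, the descent
  lemma from \<open>x\<close> to \<open>p\<close>, and the gradient inequality from \<open>x\<close>
  to \<open>u\<close>. The terms in \<open>gradF x\<close> cancel because
  \<open>(u - p) + (p - x) = u - x\<close>.\<close>

lemma forward_backward_step:
  fixes R :: "'a::{real_inner, complete_space} \<Rightarrow> ereal"
  assumes R: "proper_fun R" "convex_fun R" "lsc_fun R" and \<gamma>: "\<gamma> > 0"
    and minorant: "\<And>u. ereal (c + inner u a) \<le> R u"
    and F: "convex_on UNIV F" "\<And>y. GDERIV F y :> gradF y" "L-lipschitz_on UNIV gradF"
    and p: "p = prox \<gamma> R (x - \<gamma> *\<^sub>R gradF x)"
  shows "ereal (F p) + R p + ereal (inner (x - p) (u - p) / \<gamma> - L / 2 * (norm (x - p))\<^sup>2)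
    \<le> ereal (F u) + R u"
proof -
  have "\<bar>R p\<bar> \<noteq> \<infinity>" unfolding p by (rule prox_subgradient(1)[OF R \<gamma> minorant])
  then obtain rp where rp: "R p = ereal rp" by auto
  have sub: "R p \<le> R u + ereal (inner (u - p) (p - (x - \<gamma> *\<^sub>R gradF x)) / \<gamma>)"
    unfolding p by (rule prox_subgradient(2)[OF R \<gamma> minorant])
  have eq: "inner (u - p) (p - (x - \<gamma> *\<^sub>R gradF x)) / \<gamma>
      = - inner (x - p) (u - p) / \<gamma> + inner (u - p) (gradF x)"
  proof -
    have "p - (x - \<gamma> *\<^sub>R gradF x) = - (x - p) + \<gamma> *\<^sub>R gradF x" by simp
    then show ?thesis
      using \<gamma> by (simp only: inner_add_right inner_minus_right inner_scaleR_right
          inner_commute[of "x - p"] add_divide_distrib) simp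
  qed
  show ?thesis
  proof (cases rule: proper_fun_cases[OF R(1), of u])
    case (1 ru)
    have "rp \<le> ru - inner (x - p) (u - p) / \<gamma> + inner (u - p) (gradF x)"
      using sub unfolding eq by (simp add: rp 1)
    moreover have "F p \<le> F x + inner (p - x) (gradF x) + L / 2 * (norm (x - p))\<^sup>2"
      using descent_lemma[OF F(2,3), of p x] by (simp add: norm_minus_commute)
    moreover have "F x + inner (u - x) (gradF x) \<le> F u"
      by (rule convex_on_gradient_le[OF F(1,2)])
    ultimately show ?thesis by (simp add: rp 1 inner_diff_left)
  qed simp
qed

section \<open>The rate of the iteration\<close>

theorem corollary3p8:
  fixes R :: "'a::{real_inner, complete_space} \<Rightarrow> ereal"
    and F :: "'a \<Rightarrow> real"
    and gradF :: "'a \<Rightarrow> 'a"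
    and \<Phi> :: "'a \<Rightarrow> ereal"
    and \<beta> \<gamma>lo \<gamma>hi \<gamma> :: real
    and \<gamma>s :: "nat \<Rightarrow> real"
    and xstar :: 'a
    and x :: "nat \<Rightarrow> 'a"
  assumes R_proper: "proper_fun R"
    and R_convex: "convex_fun R"
    and R_lsc: "lsc_fun R"
    and F_convex: "convex_on UNIV F"
    and F_grad: "\<And>y. GDERIV F y :> gradF y"
    and F_C1: "continuous_on UNIV gradF"
    and \<beta>_pos: "\<beta> > 0"
    and F_lipschitz: "(1 / \<beta>)-lipschitz_on UNIV gradF"
    and \<Phi>_eq: "\<Phi> = (\<lambda>y. ereal (F y) + R y)"
    and Argmin_nonempty: "Argmin \<Phi> \<noteq> {}"
    and xstar: "xstar \<in> Argmin \<Phi>"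
    and \<gamma>lo_pos: "0 < \<gamma>lo"
    and \<gamma>s_bounds: "\<And>k. \<gamma>lo \<le> \<gamma>s k \<and> \<gamma>s k \<le> \<gamma>hi"
    and \<gamma>hi_less: "\<gamma>hi < 2 * \<beta>"
    and \<gamma>s_lim: "\<gamma>s \<longlonglongrightarrow> \<gamma>"
    and \<gamma>_range: "\<gamma> \<in> {\<gamma>lo..\<gamma>hi}"
    and \<gamma>s_summable: "summable (\<lambda>k. \<bar>\<gamma>s k - \<gamma>\<bar>)"
    and iteration: "\<And>k. x (Suc k) = prox (\<gamma>s k) R (x k - \<gamma>s k *\<^sub>R gradF (x k))"
  shows "smallo_ereal (\<lambda>k. \<Phi> (x k) - \<Phi> xstar) (\<lambda>k. 1 / (real k + 1))"
proof -
  have min: "ereal (F xstar) + R xstar \<le> ereal (F u) + R u" for u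
    using xstar by (auto simp: Argmin_def is_arg_min_def \<Phi>_eq not_less)
  obtain rs where rs: "R xstar = ereal rs"
    using subgradient_of_minimizer(1)[OF R_proper R_convex F_grad min] by auto
  txt \<open>This affine minorant makes the prox objectives bounded below, so that \<^const>\<open>prox\<close> is attained.\<close>
  have minorant: "ereal ((rs + inner xstar (gradF xstar)) + inner u (- gradF xstar)) \<le> R u" for u
    using subgradient_of_minimizer(2)[OF R_proper R_convex F_grad min, of u]
    by (cases rule: proper_fun_cases[OF R_proper, of u]) (auto simp: rs inner_diff_left)
  have \<gamma>pos: "\<gamma>s k > 0" for k using \<gamma>lo_pos \<gamma>s_bounds[of k] by linarith
  note step = forward_backward_step[OF R_proper R_convex R_lsc \<gamma>pos minorant F_convex F_grad
      F_lipschitz iteration]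
  \<comment> \<open>Index shift: \<open>v k\<close> is the gap at \<open>x (Suc k)\<close>, which is
    a prox point and so has finite value.\<close>
  define v where "v = (\<lambda>k. real_of_ereal (\<Phi> (x (Suc k)) - \<Phi> xstar))"
  have Rfin: "\<bar>R (x (Suc k))\<bar> \<noteq> \<infinity>" for k
    unfolding iteration by (rule prox_subgradient(1)[OF R_proper R_convex R_lsc \<gamma>pos minorant])
  have fin: "\<bar>\<Phi> (x (Suc k)) - \<Phi> xstar\<bar> \<noteq> \<infinity>" for k
    using Rfin[of k] by (cases "R (x (Suc k))") (auto simp: \<Phi>_eq rs)
  have \<Phi>x: "ereal (F (x (Suc k))) + R (x (Suc k)) = ereal (F xstar + rs + v k)" for k
    using fin[of k] unfolding v_def by (cases "R (x (Suc k))") (auto simp: \<Phi>_eq rs)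
  have v0: "v k \<ge> 0" for k using min[of "x (Suc k)"] unfolding \<Phi>x by (simp add: rs)
  define d where "d = (\<lambda>k. (norm (x k - x (Suc k)))\<^sup>2)"
  define e where "e = (\<lambda>k. (norm (x k - xstar))\<^sup>2)"
  \<comment> \<open>For \<open>u = x k\<close> the inner product in \<open>step\<close> is the
    squared step length, with net coefficient \<open>1 / \<gamma>s k - 1 / (2 * \<beta>)\<close>;
    \<open>\<kappa>\<close> is a lower bound for it that does not depend on
    \<open>k\<close>.\<close>
  define \<kappa> where "\<kappa> = 1 / \<gamma>hi - 1 / (2 * \<beta>)"
  have hi: "0 < \<gamma>hi" using \<gamma>pos[of 0] \<gamma>s_bounds[of 0] by linarith
  have \<kappa>: "\<kappa> > 0" unfolding \<kappa>_def using hi \<gamma>hi_less \<beta>_pos by (simp add: field_simps)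
  have d0: "d k \<ge> 0" and e0: "e k \<ge> 0" for k by (auto simp: d_def e_def)
  \<comment> \<open>The step inequality is used from index \<open>Suc k\<close> on, where both
    objective values are finite. It therefore controls only \<open>d (Suc k)\<close>; the single
    term \<open>d 0\<close> is restored afterwards without affecting summability.\<close>
  have decr: "v (Suc k) + \<kappa> * d (Suc k) \<le> v k" for k
  proof -
    have "v (Suc k) + (d (Suc k) / \<gamma>s (Suc k) - 1 / \<beta> / 2 * d (Suc k)) \<le> v k"
      using step[of "Suc k" "x (Suc k)"] unfolding \<Phi>x
      by (simp add: d_def power2_norm_eq_inner)
    moreover have "d (Suc k) / \<gamma>hi \<le> d (Suc k) / \<gamma>s (Suc k)"
      using \<gamma>pos[of "Suc k"] \<gamma>s_bounds[of "Suc k"] d0 by (intro divide_left_mono) auto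
    ultimately show ?thesis by (simp add: \<kappa>_def algebra_simps)
  qed
  have "summable (\<lambda>k. \<kappa> * d (Suc k))"
    by (rule summable_of_telescoping_bound[where b = v and s = "\<lambda>_. 0"])
      (use decr \<kappa> d0 v0 in \<open>auto simp: add.commute\<close>)
  then have "summable (\<lambda>k. d (Suc k))" using \<kappa> by (simp add: summable_mult_D)
  then have dsum: "summable d" by (simp only: summable_Suc_iff)
  \<comment> \<open>Multiplying by \<open>\<gamma>s k\<close> frees the inner product
    \<open>I\<close> of the varying step size, and polarization gives
    \<open>2 * I = d k + e (Suc k) - e k\<close>, which telescopes. Since
    \<open>\<gamma>s k / \<beta> / 2 \<le> 1\<close>, doubling leaves at most \<open>2 * d k\<close>
    on the right, one copy of which is absorbed by \<open>2 * I\<close>.\<close>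
  have energy: "2 * \<gamma>lo * v k + e (Suc k) \<le> e k + d k" for k
  proof -
    define I where "I = inner (x k - x (Suc k)) (xstar - x (Suc k))"
    have "v k + (I / \<gamma>s k - 1 / \<beta> / 2 * d k) \<le> 0"
      using step[of k xstar] unfolding \<Phi>x I_def by (simp add: d_def rs)
    then have "\<gamma>s k * (v k + (I / \<gamma>s k - 1 / \<beta> / 2 * d k)) \<le> 0"
      using \<gamma>pos[of k] by (simp add: mult_nonneg_nonpos)
    moreover have "\<gamma>s k * (v k + (I / \<gamma>s k - 1 / \<beta> / 2 * d k))
        = \<gamma>s k * v k + I - \<gamma>s k / \<beta> / 2 * d k"
      using \<gamma>pos[of k] by (simp add: field_simps)
    ultimately have "\<gamma>s k * v k + I \<le> \<gamma>s k / \<beta> / 2 * d k" by linarith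
    moreover have "2 * I = d k + e (Suc k) - e k"
      by (simp add: I_def d_def e_def power2_norm_eq_inner inner_diff_left inner_diff_right inner_commute)
    moreover have "\<gamma>s k / \<beta> / 2 * d k \<le> 1 * d k"
      using \<gamma>s_bounds[of k] \<gamma>hi_less \<beta>_pos d0 by (intro mult_right_mono) (auto simp: field_simps)
    moreover have "\<gamma>lo * v k \<le> \<gamma>s k * v k"
      using \<gamma>s_bounds[of k] v0 by (intro mult_right_mono) auto
    ultimately show ?thesis by linarith
  qed
  have "summable (\<lambda>k. 2 * \<gamma>lo * v k)"
    by (rule summable_of_telescoping_bound[where b = e and s = d, OF _ _ _ dsum energy])
      (use \<gamma>lo_pos d0 v0 e0 in auto)
  then have vsum: "summable v" using \<gamma>lo_pos by (simp add: summable_mult_D)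
  txt \<open>\<open>\<Phi> (x 0)\<close> may be infinite, so the gap sequence is patched at index 0.\<close>
  define w where "w = (\<lambda>k. if k = 0 then v 0 else v (k - 1))"
  have "decseq w"
  proof (rule decseq_SucI)
    fix k show "w (Suc k) \<le> w k"
    proof (cases k)
      case (Suc j)
      have "0 \<le> \<kappa> * d (Suc j)" using \<kappa> d0[of "Suc j"] by simp
      then show ?thesis using decr[of j] Suc by (simp add: w_def)
    qed (simp add: w_def)
  qed
  moreover have "summable w"
    using vsum summable_Suc_iff[of w] by (simp add: w_def)
  ultimately have w: "w \<in> o(\<lambda>k. 1 / (real k + 1))" by (rule decseq_summable_smallo)
  \<comment> \<open>The patched sequence and the true gap agree from index 1 on, which suffices for
    an asymptotic statement.\<close>
  have "\<forall>\<^sub>F k in sequentially. w k = real_of_ereal (\<Phi> (x k) - \<Phi> xstar)"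
    using eventually_gt_at_top[of 0]
    by (rule eventually_mono) (auto simp: w_def v_def)
  from landau_o.small.in_cong[OF this] w
  have "(\<lambda>k. real_of_ereal (\<Phi> (x k) - \<Phi> xstar)) \<in> o(\<lambda>k. 1 / (real k + 1))" by blast
  moreover have "\<forall>\<^sub>F k in sequentially. \<bar>\<Phi> (x k) - \<Phi> xstar\<bar> \<noteq> \<infinity>"
    using eventually_gt_at_top[of 0]
  proof (rule eventually_mono)
    fix k :: nat assume "0 < k"
    then show "\<bar>\<Phi> (x k) - \<Phi> xstar\<bar> \<noteq> \<infinity>" using fin[of "k - 1"] by simp
  qed
  ultimately show ?thesis unfolding smallo_ereal_def by blast
qed

end
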